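(* Let $z=(z_1,z_2)\in\mathbb R^2$ and $a(t)=(\cos t+z_1,\sin t+z_2)$ for $t\in[t_{\min},t_{\max}]$. Suppose that $T=t_{\max}-t_{\min}<2\pi$. Then the direction $\hat x=(\cos\theta,\sin\theta)$ is observable if $\theta\in\left[\frac{t_{\max}+t_{\min}}2,\ \frac{t_{\max}+t_{\min}}2+\pi\right]$.
   Context: Let $0<t_{\min}<t_{\max}$. For an orbit function $a\in C^1([t_{\min},t_{\max}];\mathbb R^2)$ and a unit vector $\hat x\in\mathbb S^1$, put $h(t)=\hat x\cdot a(t)+t$, $\xi_{\min}^{(\hat x)}=\inf_{[t_{\min},t_{\max}]}h$, $\xi_{\max}^{(\hat x)}=\sup_{[t_{\min},t_{\max}]}h$. The direction $\hat x$ is called observable if $\xi_{\max}^{(\hat x)}-\xi_{\min}^{(\hat x)}\ge T$ (and non-observable otherwise). *)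

theory Defs
  imports "HOL-Analysis.Analysis"
begin

text \<open>
  An orbit is a function on the whole real line of which only the values on
  \<open>{tmin..tmax}\<close> matter. The definitions are meant for orbits that are continuously
  differentiable on \<open>{tmin..tmax}\<close> with \<open>tmin < tmax\<close> and for unit vectors \<open>x\<close>; the infimum
  and supremum are then taken over nonempty bounded sets.
\<close>

definition h_fun :: "(real \<Rightarrow> real^2) \<Rightarrow> real^2 \<Rightarrow> real \<Rightarrow> real" where
  "h_fun a x t = x \<bullet> a t + t"

definition xi_min :: "real \<Rightarrow> real \<Rightarrow> (real \<Rightarrow> real^2) \<Rightarrow> real^2 \<Rightarrow> real" where
  "xi_min tmin tmax a x = (INF t\<in>{tmin..tmax}. h_fun a x t)"

definition xi_max :: "real \<Rightarrow> real \<Rightarrow> (real \<Rightarrow> real^2) \<Rightarrow> real^2 \<Rightarrow> real" where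
  "xi_max tmin tmax a x = (SUP t\<in>{tmin..tmax}. h_fun a x t)"

definition observable ::
  "real \<Rightarrow> real \<Rightarrow> real \<Rightarrow> (real \<Rightarrow> real^2) \<Rightarrow> real^2 \<Rightarrow> bool" where
  "observable T tmin tmax a x \<longleftrightarrow> xi_max tmin tmax a x - xi_min tmin tmax a x \<ge> T"

end

theory Submission
  imports Defs
begin

text \<open>
  On the time interval \<open>h(t) = cos (t - \<theta>) + t + c\<close>, so already the two endpoint values differ by
  at least \<open>T\<close>: with \<open>m = (tmax + tmin) / 2\<close>, one has
  \<open>h(tmax) - h(tmin) = T + 2 sin (\<theta> - m) sin (T / 2)\<close>, and both sines are nonnegative.
\<close>

text \<open>The supremum and infimum bound the endpoint values. Continuity on the compact interval
  supplies the boundedness without which \<open>SUP\<close> and \<open>INF\<close> over the reals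
  say nothing.\<close>

lemma observable_if_endpoint_gap:
  assumes "tmin \<le> tmax" and cont: "continuous_on {tmin..tmax} (h_fun a x)"
    and gap: "h_fun a x tmax - h_fun a x tmin \<ge> T"
  shows "observable T tmin tmax a x"
proof -
  have bdd: "bounded (h_fun a x ` {tmin..tmax})"
    using cont by (intro compact_imp_bounded compact_continuous_image) auto
  have "xi_min tmin tmax a x \<le> h_fun a x tmin"
    unfolding xi_min_def using assms(1) by (intro cINF_lower bounded_imp_bdd_below bdd) auto
  moreover have "h_fun a x tmax \<le> xi_max tmin tmax a x"
    unfolding xi_max_def using assms(1) by (intro cSUP_upper bounded_imp_bdd_above bdd) auto
  ultimately show ?thesis
    using gap by (simp add: observable_def)
qed

lemma cos_endpoint_le:
  fixes s t \<theta> :: real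
  assumes "s \<le> t" "t - s \<le> 2 * pi" "\<theta> \<in> {(t + s) / 2 .. (t + s) / 2 + pi}"
  shows "cos (s - \<theta>) \<le> cos (t - \<theta>)"
proof -
  \<comment> \<open>These are the sine arguments produced by \<open>cos_diff_cos\<close>; both are
    negated, and the two signs cancel.\<close>
  have "(t - \<theta> + (s - \<theta>)) / 2 = - (\<theta> - (t + s) / 2)" "(s - \<theta> - (t - \<theta>)) / 2 = - ((t - s) / 2)"
    by (simp_all add: field_simps)
  then have "cos (t - \<theta>) - cos (s - \<theta>) = 2 * (sin (\<theta> - (t + s) / 2) * sin ((t - s) / 2))"
    by (simp only: cos_diff_cos sin_minus)
  also have "\<dots> \<ge> 0"
    \<comment> \<open>The hypotheses place both arguments in [0, pi].\<close>
    using assms by (intro mult_nonneg_nonneg sin_ge_zero) auto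
  finally show ?thesis by simp
qed

theorem lemma3p8:
  fixes tmin tmax T \<theta> :: real
    and z :: "real^2"
    and a :: "real \<Rightarrow> real^2"
  assumes "0 < tmin" and "tmin < tmax"
    and "\<And>t. t \<in> {tmin..tmax} \<Longrightarrow> a t = vector [cos t + z $ 1, sin t + z $ 2]"
    and "T = tmax - tmin" and "T < 2 * pi"
    and "\<theta> \<in> {(tmax + tmin) / 2 .. (tmax + tmin) / 2 + pi}"
  shows "observable T tmin tmax a (vector [cos \<theta>, sin \<theta>])"
proof (rule observable_if_endpoint_gap)
  \<comment> \<open>The share of the centre \<open>z\<close> is constant in time, so it cancels
    between the endpoints.\<close>
  define c where "c = cos \<theta> * z $ 1 + sin \<theta> * z $ 2"
  have h: "h_fun a (vector [cos \<theta>, sin \<theta>]) t = cos (t - \<theta>) + c + t" if "t \<in> {tmin..tmax}" for t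
    using assms(3)[OF that]
    by (simp add: h_fun_def inner_vec_def sum_2 cos_diff c_def algebra_simps)
  show "tmin \<le> tmax"
    using assms(2) by simp
  have "continuous_on {tmin..tmax} (\<lambda>t. cos (t - \<theta>) + c + t)"
    by (intro continuous_intros)
  then show "continuous_on {tmin..tmax} (h_fun a (vector [cos \<theta>, sin \<theta>]))"
    \<comment> \<open>The orbit is prescribed only on the interval, so continuity is transferred by
      agreement there.\<close>
    by (rule continuous_on_cong[THEN iffD1, rotated -1]) (simp_all add: h)
  have "cos (tmin - \<theta>) \<le> cos (tmax - \<theta>)"
    using assms by (intro cos_endpoint_le) auto
  then show "T \<le> h_fun a (vector [cos \<theta>, sin \<theta>]) tmax - h_fun a (vector [cos \<theta>, sin \<theta>]) tmin"
    using h[of tmax] h[of tmin] assms(2,4) by simp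
qed

end
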